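(* Let $\mathbb{F}_q$ be a finite field, let $d$ and $k$ be positive integers with $d<k$, and let $H_d\in\mathbb{F}_q[X_1,\ldots,X_{k+1}]$ be the polynomial associated to the monomial $T^{k+d}$. Then $$H_d=\sum_{i_1+2i_2+\cdots+d\,i_d=d}(-1)^{\Delta(i_1,\ldots,i_d)}\,\frac{(i_1+\cdots+i_d)!}{i_1!\cdots i_d!}\,\Pi_1^{i_1}\cdots\Pi_d^{i_d},$$ where the sum is over integers $i_1,\ldots,i_d$ with $0\le i_j\le d$ for $1\le j\le d$, and $\Delta(i_1,\ldots,i_d):=i_2+i_4+\cdots+i_{2\lfloor d/2\rfloor}$ denotes the sum of the indices $i_j$ for which $j$ is even.
   Context: $\Pi_1,\ldots,\Pi_d$ denote the first $d$ elementary symmetric polynomials of $\mathbb{F}_q[X_1,\ldots,X_{k+1}]$. Put $Q=(T-X_1)\cdots(T-X_{k+1})\in\mathbb{F}_q[X_1,\ldots,X_{k+1}][T]$. The polynomial $H_d\in\mathbb{F}_q[X_1,\ldots,X_{k+1}]$ associated to $T^{k+d}$ is the coefficient of $T^k$ in the unique polynomial $R\in\mathbb{F}_q[X_1,\ldots,X_{k+1}][T]$ of degree at most $k$ in $T$ with $T^{k+d}\equiv R \bmod Q$. The multinomial coefficients (integers) are regarded as elements of $\mathbb{F}_q$. *)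

theory Defs
  imports
    "HOL-Library.Poly_Mapping"
    "HOL-Library.FuncSet"
    "HOL-Library.Cardinality"
    "HOL-Computational_Algebra.Polynomial"
begin

text \<open>
  The ring of polynomials over \<open>'a\<close> in the variables \<open>X i\<close>, \<open>i :: 'n\<close>: a monomial is a finitely
  supported exponent vector, and the product of the library type is convolution. For a finite
  type \<open>'n\<close> with \<open>CARD('n) = k + 1\<close> this is exactly the polynomial ring in \<open>k + 1\<close> variables.
\<close>

type_synonym ('n, 'a) mpoly = "('n \<Rightarrow>\<^sub>0 nat) \<Rightarrow>\<^sub>0 'a"

definition Var :: "'n \<Rightarrow> ('n, 'a::comm_ring_1) mpoly" where
  "Var i = Poly_Mapping.single (Poly_Mapping.single i 1) 1"

definition Const :: "'a \<Rightarrow> ('n, 'a::comm_ring_1) mpoly" where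
  "Const c = Poly_Mapping.single 0 c"

definition elem_sym :: "nat \<Rightarrow> ('n::finite, 'a::comm_ring_1) mpoly" where
  "elem_sym j = (\<Sum>A | card A = j. \<Prod>i\<in>A. Var i)"

text \<open>Univariate polynomials over the ring above play the role of polynomials in \<open>T\<close>.\<close>

definition Q_poly :: "('n::finite, 'a::comm_ring_1) mpoly poly" where
  "Q_poly = (\<Prod>i\<in>UNIV. [:- Var i, 1:])"

definition is_remainder :: "nat \<Rightarrow> ('n::finite, 'a::comm_ring_1) mpoly poly \<Rightarrow>
    ('n, 'a) mpoly poly \<Rightarrow> bool" where
  "is_remainder k F R \<longleftrightarrow> degree R \<le> k \<and> Q_poly dvd (F - R)"

text \<open>
  The definite description is meant for \<open>CARD('n) = k + 1\<close>, where \<open>remainder_ex1\<close> below shows that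
  it is well defined. The library operation \<open>mod\<close> is not available here, since it needs
  coefficients in a field.
\<close>

definition associated_poly :: "nat \<Rightarrow> ('n::finite, 'a::comm_ring_1) mpoly poly \<Rightarrow>
    ('n, 'a) mpoly" where
  "associated_poly k F = coeff (THE R. is_remainder k F R) k"

definition index_tuples :: "nat \<Rightarrow> (nat \<Rightarrow> nat) set" where
  "index_tuples d = {i \<in> {1..d} \<rightarrow>\<^sub>E {0..d}. (\<Sum>j=1..d. j * i j) = d}"

definition Delta :: "nat \<Rightarrow> (nat \<Rightarrow> nat) \<Rightarrow> nat" where
  "Delta d i = (\<Sum>m=1..d div 2. i (2 * m))"

text \<open>The division is exact.\<close>

definition multinomial :: "nat \<Rightarrow> (nat \<Rightarrow> nat) \<Rightarrow> nat" where
  "multinomial d i = fact (\<Sum>j=1..d. i j) div (\<Prod>j=1..d. fact (i j))"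

lemma monic_prod_linear:
  fixes f :: "'i \<Rightarrow> 'b::comm_ring_1"
  assumes "finite A"
  shows "degree (\<Prod>i\<in>A. [:f i, 1:]) = card A \<and> lead_coeff (\<Prod>i\<in>A. [:f i, 1:]) = 1"
  using assms
proof (induction A rule: finite_induct)
  case empty
  then show ?case by simp
next
  case (insert x A)
  let ?p = "[:f x, 1:]" and ?q = "\<Prod>i\<in>A. [:f i, 1:]"
  have c: "coeff (?p * ?q) (Suc (card A)) = 1"
    using coeff_mult_degree_sum[of ?p ?q] insert.IH by (auto simp del: mult_pCons_left)
  have "degree (?p * ?q) \<le> Suc (card A)"
    using degree_mult_le[of ?p ?q] insert.IH by simp
  moreover have "Suc (card A) \<le> degree (?p * ?q)"
    using c by (intro le_degree) (simp del: mult_pCons_left)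
  ultimately have "degree (?p * ?q) = Suc (card A)" by simp
  then show ?case
    using c insert.hyps by (simp del: mult_pCons_left)
qed

lemma remainder_ex1:
  fixes F :: "('n::finite, 'a::comm_ring_1) mpoly poly"
  assumes "CARD('n) = k + 1"
  shows "\<exists>!R. is_remainder k F R"
proof -
  let ?Q = "Q_poly :: ('n, 'a) mpoly poly"
  have Q: "degree ?Q = Suc k" "coeff ?Q (Suc k) = 1"
    using monic_prod_linear[of "UNIV :: 'n set" "\<lambda>i. - Var i :: ('n, 'a) mpoly"] assms
    unfolding Q_poly_def by auto
  then have Q0: "?Q \<noteq> 0" by auto
  obtain S R where SR: "pseudo_divmod F ?Q = (S, R)" by fastforce
  have "F = ?Q * S + R"
    using pseudo_divmod(1)[OF Q0 SR] Q by simp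
  moreover have "degree R \<le> k"
    using pseudo_divmod(2)[OF Q0 SR] Q by auto
  ultimately have ex: "is_remainder k F R"
    unfolding is_remainder_def by auto
  have "R1 = R2" if "is_remainder k F R1" "is_remainder k F R2" for R1 R2
  proof (rule ccontr)
    assume ne: "R1 \<noteq> R2"
    have "?Q dvd (F - R2) - (F - R1)"
      using that unfolding is_remainder_def by (metis dvd_diff)
    then obtain U where U: "R1 - R2 = ?Q * U"
      by (auto elim: dvdE)
    then have "U \<noteq> 0" using ne by auto
    then have "coeff (?Q * U) (Suc k + degree U) \<noteq> 0"
      using coeff_mult_degree_sum[of ?Q U] Q by simp
    then have "Suc k \<le> degree (R1 - R2)"
      using U le_degree by fastforce
    moreover have "degree (R1 - R2) \<le> k"
      using that unfolding is_remainder_def by (intro degree_diff_le) auto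
    ultimately show False by simp
  qed
  with ex show ?thesis by blast
qed

end

theory Submission
  imports Defs
begin

text \<open>
  Write \<open>H\<^sub>e\<close> for the polynomial associated to \<open>T\<^bsup>k+e\<^esup>\<close> and put \<open>c\<^sub>j = (-1)\<^bsup>j+1\<^esup> \<Pi>\<^sub>j\<close>. Both
  sides of the identity solve the same linear recurrence, and that is the whole proof.

  By Vieta, \<open>Q = T\<^bsup>k+1\<^esup> - c\<^sub>1 T\<^bsup>k\<^esup> - c\<^sub>2 T\<^bsup>k-1\<^esup> - \<dots>\<close>. The map sending \<open>F\<close> to the coefficient of
  \<open>T\<^bsup>k\<^esup>\<close> in its remainder is linear and kills \<open>T\<^bsup>e-1\<^esup> Q\<close>; it also kills \<open>T\<^bsup>m\<^esup>\<close> for \<open>m < k\<close>. Hence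
  \<open>H\<^sub>e = c\<^sub>1 H\<^sub>e\<^sub>-\<^sub>1 + \<dots> + c\<^sub>e H\<^sub>0\<close> for \<open>1 \<le> e \<le> k + 1\<close>, with \<open>H\<^sub>0 = 1\<close>
  (lemma \<open>associated_poly_recurrence\<close>). In terms of generating functions, \<open>\<Sum>\<^sub>e H\<^sub>e z\<^sup>e\<close> is the
  inverse of \<open>1 - \<Sum>\<^sub>j c\<^sub>j z\<^sup>j\<close>.

  The multinomial coefficient of \<open>(i\<^sub>1, i\<^sub>2, \<dots>)\<close> counts the words with \<open>i\<^sub>j\<close> letters \<open>j\<close>. So the sum
  of \<open>multinomial \<cdot> c\<^sub>1\<^bsup>i\<^sub>1\<^esup> c\<^sub>2\<^bsup>i\<^sub>2\<^esup> \<dots>\<close> over the tuples with \<open>i\<^sub>1 + 2i\<^sub>2 + \<dots> = e\<close> is the sum of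
  \<open>c\<^bsub>w(1)\<^esub> c\<^bsub>w(2)\<^esub> \<dots>\<close> over all compositions \<open>w\<close> of \<open>e\<close>. Splitting off the first part \<open>j\<close> of the composition
  gives the same recurrence (lemma \<open>multinomial_sum_recurrence\<close>); on the level of coefficients this is
  Pascal's rule for multinomials. Finally, the signs of the \<open>c\<^sub>j\<close> combine to \<open>(-1)\<^bsup>\<Delta>\<^esup>\<close>, since \<open>c\<^sub>j\<close>
  carries a minus sign exactly for even \<open>j\<close>.
\<close>

section \<open>Pascal's rule for multinomial coefficients\<close>

lemma prod_fact_dvd_fact_sum:
  fixes i :: "'b \<Rightarrow> nat"
  assumes "finite A"
  shows "(\<Prod>j\<in>A. fact (i j)) dvd (fact (\<Sum>j\<in>A. i j) :: nat)"
  using assms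
proof (induction A rule: finite_induct)
  case (insert x A)
  have "fact (i x) * (\<Prod>j\<in>A. fact (i j)) dvd (fact (i x) * fact (\<Sum>j\<in>A. i j) :: nat)"
    using insert.IH by (rule mult_dvd_mono[OF dvd_refl])
  also have "\<dots> dvd fact (i x + (\<Sum>j\<in>A. i j))"
    by (rule fact_fact_dvd_fact)
  finally show ?case using insert.hyps by simp
qed simp

lemma prod_fact_mult_multinomial:
  "(\<Prod>j=1..N. fact (i j)) * multinomial N i = fact (\<Sum>j=1..N. i j)"
  unfolding multinomial_def
  by (rule dvd_mult_div_cancel) (rule prod_fact_dvd_fact_sum, simp)

text \<open>
  A word with \<open>i j\<close> letters \<open>j\<close> is determined by its first letter and the remaining word. In the
  proof both sides are multiplied by \<open>\<Prod>j. fact (i j)\<close>; the term for \<open>j\<close> then becomes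
  \<open>i j * fact (n - 1)\<close>, where \<open>n\<close> is the length of the word.
\<close>

lemma multinomial_Pascal:
  assumes "(\<Sum>j=1..N. i j) > 0"
  shows "multinomial N i = (\<Sum>j | j \<in> {1..N} \<and> i j > 0. multinomial N (i(j := i j - 1)))"
proof -
  let ?n = "\<Sum>j=1..N. i j"
  let ?P = "\<lambda>i. \<Prod>j=1..N. fact (i j) :: nat"
  have step: "?P i * multinomial N (i(j := i j - 1)) = i j * fact (?n - 1)"
    if j: "j \<in> {1..N}" "i j > 0" for j
  proof -
    let ?i = "i(j := i j - 1)"
    have "?P i = fact (i j) * (\<Prod>l\<in>{1..N}-{j}. fact (i l))"
      using j by (intro prod.remove) auto
    moreover have "?P ?i = fact (i j - 1) * (\<Prod>l\<in>{1..N}-{j}. fact (i l))"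
      using j by (subst prod.remove[of _ j]) auto
    moreover have "fact (i j) = i j * (fact (i j - 1) :: nat)"
      using j by (simp add: fact_reduce)
    ultimately have P: "?P i = i j * ?P ?i" by simp
    have "?n = i j + (\<Sum>l\<in>{1..N}-{j}. i l)"
      using j by (intro sum.remove) auto
    moreover have "(\<Sum>l=1..N. ?i l) = i j - 1 + (\<Sum>l\<in>{1..N}-{j}. i l)"
      using j by (subst sum.remove[of _ j]) auto
    ultimately have "(\<Sum>l=1..N. ?i l) = ?n - 1" using j by simp
    then show ?thesis
      unfolding P using prod_fact_mult_multinomial[of ?i N] by (simp only: mult.assoc)
  qed
  have "?P i * (\<Sum>j | j \<in> {1..N} \<and> i j > 0. multinomial N (i(j := i j - 1)))
      = (\<Sum>j | j \<in> {1..N} \<and> i j > 0. i j * fact (?n - 1))"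
    using step by (subst sum_distrib_left, intro sum.cong) auto
  also have "\<dots> = (\<Sum>j=1..N. i j * fact (?n - 1))"
    by (intro sum.mono_neutral_left) auto
  also have "\<dots> = fact ?n"
    using assms by (simp add: sum_distrib_right[symmetric] fact_reduce)
  also have "\<dots> = ?P i * multinomial N i"
    by (rule prod_fact_mult_multinomial[symmetric])
  finally show ?thesis by simp
qed

section \<open>The recurrence for sums over tuples of given weight\<close>

text \<open>
  The length \<open>N\<close> of the tuples is kept apart from their weight \<open>e\<close>, so that \<open>e\<close> can vary in the
  recurrence while \<open>N\<close> stays the same.
\<close>

definition weight_tuples :: "nat \<Rightarrow> nat \<Rightarrow> (nat \<Rightarrow> nat) set" where
  "weight_tuples N e = {i \<in> extensional {1..N}. (\<Sum>j=1..N. j * i j) = e}"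

lemma weight_tuples_bound:
  assumes "i \<in> weight_tuples N e" "j \<in> {1..N}"
  shows "j * i j \<le> e" "i j \<le> e"
proof -
  show "j * i j \<le> e"
    using assms member_le_sum[of j "{1..N}" "\<lambda>j. j * i j"] by (auto simp: weight_tuples_def)
  moreover have "i j \<le> j * i j"
    using assms by simp
  ultimately show "i j \<le> e" by (rule order_trans[rotated])
qed

lemma weight_tuples_eq_PiE:
  "weight_tuples N e = {i \<in> {1..N} \<rightarrow>\<^sub>E {0..e}. (\<Sum>j=1..N. j * i j) = e}"
  using weight_tuples_bound(2)[of _ N e] by (auto simp: weight_tuples_def PiE_def)

lemma finite_weight_tuples: "finite (weight_tuples N e)"
  unfolding weight_tuples_eq_PiE
  by (rule finite_subset[of _ "{1..N} \<rightarrow>\<^sub>E {0..e}"]) (auto intro: finite_PiE)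

lemma weight_fun_upd:
  fixes i :: "nat \<Rightarrow> nat"
  assumes "j \<in> {1..N}"
  shows "(\<Sum>l=1..N. l * (i(j := m)) l) + j * i j = (\<Sum>l=1..N. l * i l) + j * m"
proof -
  have "(\<Sum>l=1..N. l * (i(j := m)) l) = j * m + (\<Sum>l\<in>{1..N}-{j}. l * i l)"
    using assms by (subst sum.remove[of _ j]) auto
  moreover have "(\<Sum>l=1..N. l * i l) = j * i j + (\<Sum>l\<in>{1..N}-{j}. l * i l)"
    using assms by (intro sum.remove) auto
  ultimately show ?thesis by simp
qed

definition multinomial_sum :: "nat \<Rightarrow> (nat \<Rightarrow> 'b::comm_semiring_1) \<Rightarrow> nat \<Rightarrow> 'b" where
  "multinomial_sum N c e =
    (\<Sum>i\<in>weight_tuples N e. of_nat (multinomial N i) * (\<Prod>j=1..N. c j ^ i j))"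

text \<open>
  Tuples are \<open>undefined\<close> outside \<open>{1..N}\<close>, so there is exactly one of weight 0.
\<close>

lemma multinomial_sum_0: "multinomial_sum N c 0 = 1"
proof -
  let ?z = "\<lambda>j. if j \<in> {1..N} then 0 else undefined :: nat"
  have "weight_tuples N 0 = {?z}"
    by (fastforce simp: weight_tuples_def extensional_def)
  then show ?thesis by (simp add: multinomial_sum_def multinomial_def)
qed

text \<open>
  Pascal's rule turns the sum over tuples into a sum over pairs of a tuple \<open>i\<close> and an index \<open>j\<close> with
  \<open>i j > 0\<close>. Lowering \<open>i j\<close> by one maps the pairs with given \<open>j\<close> bijectively to the tuples of
  weight \<open>e - j\<close> and takes out one factor \<open>c j\<close>.
\<close>

lemma multinomial_sum_recurrence:
  assumes "0 < e" "e \<le> N"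
  shows "multinomial_sum N c e = (\<Sum>j=1..e. c j * multinomial_sum N c (e - j))"
proof -
  let ?m = "\<lambda>i. \<Prod>j=1..N. c j ^ i j"
  let ?g = "\<lambda>i j. of_nat (multinomial N (i(j := i j - 1))) * ?m i"
  have "multinomial_sum N c e = (\<Sum>i\<in>weight_tuples N e. \<Sum>j | j \<in> {1..N} \<and> i j > 0. ?g i j)"
    unfolding multinomial_sum_def
  proof (rule sum.cong[OF refl])
    fix i assume "i \<in> weight_tuples N e"
    then have "(\<Sum>j=1..N. i j) > 0"
      using assms by (intro gr0I) (auto simp: weight_tuples_def)
    from multinomial_Pascal[OF this]
    show "of_nat (multinomial N i) * ?m i = (\<Sum>j | j \<in> {1..N} \<and> i j > 0. ?g i j)"
      by (simp add: sum_distrib_right)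
  qed
  also have "\<dots> = (\<Sum>j=1..N. \<Sum>i | i \<in> weight_tuples N e \<and> i j > 0. ?g i j)"
    by (rule sum.swap_restrict) (auto simp: finite_weight_tuples)
  also have "\<dots> = (\<Sum>j=1..e. \<Sum>i | i \<in> weight_tuples N e \<and> i j > 0. ?g i j)"
  proof (rule sum.mono_neutral_right)
    show "\<forall>j\<in>{1..N} - {1..e}. (\<Sum>i | i \<in> weight_tuples N e \<and> i j > 0. ?g i j) = 0"
    proof
      fix j assume j: "j \<in> {1..N} - {1..e}"
      have "i j = 0" if "i \<in> weight_tuples N e" for i
        using weight_tuples_bound(1)[OF that, of j] j by (cases "i j") auto
      then show "(\<Sum>i | i \<in> weight_tuples N e \<and> i j > 0. ?g i j) = 0"
        by (intro sum.neutral) fastforce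
    qed
  qed (use assms in auto)
  also have "\<dots> = (\<Sum>j=1..e. c j * multinomial_sum N c (e - j))"
  proof (rule sum.cong[OF refl])
    fix j assume "j \<in> {1..e}"
    then have j: "j \<in> {1..N}" "j \<le> e" using assms by auto
    have ext: "i(j := m) \<in> extensional {1..N}" if "i \<in> extensional {1..N}" for i and m :: nat
      using that j by (auto simp: extensional_def)
    have m: "?m (i(j := Suc (i j))) = c j * ?m i" for i
    proof -
      have "?m (i(j := Suc (i j))) = c j ^ Suc (i j) * (\<Prod>l\<in>{1..N}-{j}. c l ^ i l)"
        using j by (subst prod.remove[of _ j]) auto
      moreover have "?m i = c j ^ i j * (\<Prod>l\<in>{1..N}-{j}. c l ^ i l)"
        using j by (intro prod.remove) auto
      ultimately show ?thesis by (simp add: mult.assoc)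
    qed
    have "(\<Sum>i | i \<in> weight_tuples N e \<and> i j > 0. ?g i j) =
        (\<Sum>i\<in>weight_tuples N (e - j). c j * (of_nat (multinomial N i) * ?m i))"
    proof (rule sum.reindex_bij_witness[of _ "\<lambda>i. i(j := Suc (i j))" "\<lambda>i. i(j := i j - 1)"])
      fix i assume i: "i \<in> {i \<in> weight_tuples N e. i j > 0}"
      then show "(i(j := i j - 1))(j := Suc ((i(j := i j - 1)) j)) = i" by auto
      show "i(j := i j - 1) \<in> weight_tuples N (e - j)"
        using i ext weight_fun_upd[OF j(1), of i "i j - 1"]
        by (cases "i j") (auto simp: weight_tuples_def simp del: fun_upd_apply)
      show "c j * (of_nat (multinomial N (i(j := i j - 1))) * ?m (i(j := i j - 1))) = ?g i j"
      proof -
        have "(i(j := i j - 1))(j := Suc ((i(j := i j - 1)) j)) = i" using i by auto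
        with m[of "i(j := i j - 1)"] have "?m i = c j * ?m (i(j := i j - 1))" by (simp only:)
        then show ?thesis by (simp only: mult.left_commute)
      qed
    next
      fix i assume i: "i \<in> weight_tuples N (e - j)"
      show "(i(j := Suc (i j)))(j := (i(j := Suc (i j))) j - 1) = i" by auto
      show "i(j := Suc (i j)) \<in> {i \<in> weight_tuples N e. i j > 0}"
        using i j ext weight_fun_upd[OF j(1), of i "Suc (i j)"]
        by (auto simp: weight_tuples_def simp del: fun_upd_apply) auto
    qed
    then show "(\<Sum>i | i \<in> weight_tuples N e \<and> i j > 0. ?g i j) = c j * multinomial_sum N c (e - j)"
      by (simp add: multinomial_sum_def sum_distrib_left)
  qed
  finally show ?thesis .
qed

section \<open>The recurrence for the associated polynomials\<close>

lemma associated_poly_eqI: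
  fixes F :: "('n::finite, 'a::comm_ring_1) mpoly poly"
  assumes "CARD('n) = k + 1" "is_remainder k F R"
  shows "associated_poly k F = coeff R k"
  unfolding associated_poly_def using the1_equality[OF remainder_ex1 assms(2)] assms(1) by simp

lemma associated_poly_degree_le:
  fixes F :: "('n::finite, 'a::comm_ring_1) mpoly poly"
  assumes "CARD('n) = k + 1" "degree F \<le> k"
  shows "associated_poly k F = coeff F k"
  using assms by (intro associated_poly_eqI) (auto simp: is_remainder_def)

lemma associated_poly_multiple:
  fixes F :: "('n::finite, 'a::comm_ring_1) mpoly poly"
  assumes "CARD('n) = k + 1" "Q_poly dvd F"
  shows "associated_poly k F = 0"
  using assms associated_poly_eqI[of k F 0] by (simp add: is_remainder_def)

text \<open>
  Linear combinations of remainders are again remainders, because the degree bound and divisibility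
  by \<open>Q\<close> are both stable under linear combinations over the coefficient ring.
\<close>

lemma associated_poly_linear:
  fixes F :: "'i \<Rightarrow> ('n::finite, 'a::comm_ring_1) mpoly poly"
  assumes "CARD('n) = k + 1" "finite J"
  shows "associated_poly k (\<Sum>j\<in>J. smult (a j) (F j)) = (\<Sum>j\<in>J. a j * associated_poly k (F j))"
proof -
  have "\<forall>j. \<exists>R. is_remainder k (F j) R"
    using remainder_ex1[OF assms(1)] by blast
  then obtain R where R: "is_remainder k (F j) (R j)" for j
    by metis
  have "Q_poly dvd (\<Sum>j\<in>J. smult (a j) (F j - R j))"
    using R by (intro dvd_sum dvd_smult) (auto simp: is_remainder_def)
  moreover have "degree (\<Sum>j\<in>J. smult (a j) (R j)) \<le> k"
    using R assms(2) degree_smult_le order_trans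
    by (intro degree_sum_le) (fastforce simp: is_remainder_def)+
  ultimately have "is_remainder k (\<Sum>j\<in>J. smult (a j) (F j)) (\<Sum>j\<in>J. smult (a j) (R j))"
    by (simp add: is_remainder_def smult_diff_right sum_subtractf)
  from associated_poly_eqI[OF assms(1) this] show ?thesis
    by (simp add: coeff_sum associated_poly_eqI[OF assms(1) R])
qed

text \<open>
  Vieta's formula: expanding the product of the \<open>T - X\<^sub>i\<close> gives one term for each set of variables,
  and the terms are collected by the size of the set.
\<close>

lemma Q_poly_expansion:
  "(Q_poly :: ('n::finite, 'a::comm_ring_1) mpoly poly) =
    (\<Sum>j\<le>CARD('n). smult ((- 1) ^ j * elem_sym j) (monom 1 (CARD('n) - j)))"
proof -
  let ?V = "Var :: 'n \<Rightarrow> ('n, 'a) mpoly"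
  have lin: "[:- ?V i, 1:] = monom 1 1 - [:?V i:]" for i
    by (simp add: monom_altdef)
  have const: "(\<Prod>i\<in>A. [:?V i:]) = [:\<Prod>i\<in>A. ?V i:]" for A
    by (induction A rule: infinite_finite_induct) auto
  have pow: "(monom 1 1 :: ('n, 'a) mpoly poly) ^ m = monom 1 m" for m
    by (simp add: monom_power)
  have sgn: "(- 1) ^ m * p = smult ((- 1) ^ m) p" for m and p :: "('n, 'a) mpoly poly"
    by (cases "even m") auto
  let ?t = "\<lambda>A. smult ((- 1) ^ card A * (\<Prod>i\<in>A. ?V i)) (monom 1 (CARD('n) - card A))"
  have "(Q_poly :: ('n, 'a) mpoly poly) = (\<Sum>A\<in>UNIV. ?t A)"
    unfolding Q_poly_def lin
    by (subst prod_diff_conv_sum, simp, intro sum.cong)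
      (auto simp: const pow[simplified] sgn card_Diff_subset mult.commute)
  also have "\<dots> = (\<Sum>j\<le>CARD('n). \<Sum>A | A \<in> UNIV \<and> card A = j. ?t A)"
    by (rule sum.group[symmetric]) (auto intro: card_mono)
  also have "\<dots> = (\<Sum>j\<le>CARD('n). smult ((- 1) ^ j * elem_sym j) (monom 1 (CARD('n) - j)))"
    by (intro sum.cong) (auto simp: elem_sym_def smult_sum sum_distrib_left)
  finally show ?thesis .
qed

text \<open>
  Apply the linear map \<open>associated_poly k\<close> to \<open>T\<^bsup>e-1\<^esup> Q\<close>: the term of \<open>\<Pi>\<^sub>j\<close> comes from \<open>T\<^bsup>k+e-j\<^esup>\<close>,
  which for \<open>j > e\<close> is its own remainder and has no \<open>T\<^bsup>k\<^esup>\<close>.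
\<close>

lemma associated_poly_recurrence:
  fixes k e :: nat
  assumes k: "CARD('n::finite) = k + 1" and e: "0 < e" "e \<le> k + 1"
  defines "h \<equiv> \<lambda>e. associated_poly k (monom 1 (k + e)) :: ('n, 'a::comm_ring_1) mpoly"
  shows "h e = (\<Sum>j=1..e. (- 1) ^ (j + 1) * elem_sym j * h (e - j))"
proof -
  let ?M = "monom 1 :: nat \<Rightarrow> ('n, 'a) mpoly poly"
  let ?s = "\<lambda>j. (- 1) ^ j * elem_sym j :: ('n, 'a) mpoly"
  have "?M (e - 1) * Q_poly = (\<Sum>j\<le>k + 1. smult (?s j) (?M (k + e - j)))"
    unfolding Q_poly_expansion k sum_distrib_left
  proof (rule sum.cong[OF refl])
    fix j assume "j \<in> {..k + 1}"
    then have "e - 1 + (k + 1 - j) = k + e - j" using e by auto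
    then show "?M (e - 1) * smult (?s j) (?M (k + 1 - j)) = smult (?s j) (?M (k + e - j))"
      by (simp add: mult_monom)
  qed
  then have "0 = associated_poly k (\<Sum>j\<le>k + 1. smult (?s j) (?M (k + e - j)))"
    using associated_poly_multiple[OF k dvd_triv_right[of Q_poly "?M (e - 1)"]] by simp
  also have "\<dots> = (\<Sum>j\<le>k + 1. ?s j * associated_poly k (?M (k + e - j)))"
    by (rule associated_poly_linear[OF k]) simp
  also have "\<dots> = (\<Sum>j\<le>e. ?s j * associated_poly k (?M (k + e - j)))"
  proof (rule sum.mono_neutral_right)
    show "\<forall>j\<in>{..k + 1} - {..e}. ?s j * associated_poly k (?M (k + e - j)) = 0"
    proof
      fix j assume "j \<in> {..k + 1} - {..e}"
      then have "k + e - j < k" using e by auto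
      then have "associated_poly k (?M (k + e - j)) = 0"
        by (subst associated_poly_degree_le[OF k]) (auto simp: degree_monom_eq)
      then show "?s j * associated_poly k (?M (k + e - j)) = 0" by simp
    qed
  qed (use e in auto)
  also have "\<dots> = (\<Sum>j\<le>e. ?s j * h (e - j))"
    by (intro sum.cong) (auto simp: h_def)
  also have "\<dots> = h e + (\<Sum>j=1..e. ?s j * h (e - j))"
    by (simp add: atMost_atLeast0 sum.atLeast_Suc_atMost elem_sym_def)
  finally have "h e = - (\<Sum>j=1..e. ?s j * h (e - j))"
    by (simp add: eq_neg_iff_add_eq_0)
  then show ?thesis
    by (simp add: sum_negf)
qed

section \<open>Comparing the two sides\<close>

lemma associated_poly_eq_multinomial_sum:
  fixes k e N :: nat
  assumes k: "CARD('n::finite) = k + 1" and "e \<le> N" "N \<le> k + 1"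
  shows "(associated_poly k (monom 1 (k + e)) :: ('n, 'a::comm_ring_1) mpoly) =
    multinomial_sum N (\<lambda>j. (- 1) ^ (j + 1) * elem_sym j) e"
  using assms(2)
proof (induction e rule: less_induct)
  case (less e)
  show ?case
  proof (cases "e = 0")
    case True
    then show ?thesis
      by (simp add: multinomial_sum_0 associated_poly_degree_le[OF k] degree_monom_eq)
  next
    case False
    then have e: "0 < e" "e \<le> k + 1" using less.prems assms(3) by auto
    let ?c = "\<lambda>j. (- 1) ^ (j + 1) * elem_sym j :: ('n, 'a) mpoly"
    have "(associated_poly k (monom 1 (k + e)) :: ('n, 'a) mpoly) =
        (\<Sum>j=1..e. ?c j * associated_poly k (monom 1 (k + (e - j))))"
      by (rule associated_poly_recurrence[OF k e])
    also have "\<dots> = (\<Sum>j=1..e. ?c j * multinomial_sum N ?c (e - j))"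
    proof (rule sum.cong[OF refl])
      fix j assume "j \<in> {1..e}"
      then show "?c j * associated_poly k (monom 1 (k + (e - j))) = ?c j * multinomial_sum N ?c (e - j)"
        using less.IH[of "e - j"] less.prems by simp
    qed
    also have "\<dots> = multinomial_sum N ?c e"
      using e less.prems by (intro multinomial_sum_recurrence[symmetric])
    finally show ?thesis .
  qed
qed

lemma prod_sign_eq_Delta:
  "(\<Prod>j=1..d. ((- 1) ^ (j + 1)) ^ i j) = ((- 1) ^ Delta d i :: 'b::comm_ring_1)"
proof -
  have "(\<Prod>j=1..d. ((- 1) ^ (j + 1)) ^ i j) = (\<Prod>j | j \<in> {1..d} \<and> even j. (- 1 :: 'b) ^ i j)"
    by (intro prod.mono_neutral_cong_right) auto
  also have "\<dots> = (\<Prod>m=1..d div 2. (- 1) ^ i (2 * m))"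
    by (rule prod.reindex_bij_witness[of _ "\<lambda>m. 2 * m" "\<lambda>j. j div 2"]) auto
  also have "\<dots> = (- 1) ^ Delta d i"
    by (simp add: Delta_def power_sum)
  finally show ?thesis .
qed

lemma Const_of_nat: "Const (of_nat m) = of_nat m"
  by (simp add: Const_def)

theorem proposition2p2:
  fixes d k :: nat
  assumes "0 < d" and "d < k" and "CARD('n::finite) = k + 1"
  shows "(associated_poly k (monom 1 (k + d)) :: ('n, 'a::{field, finite}) mpoly) =
    (\<Sum>i\<in>index_tuples d.
      (- 1) ^ Delta d i * Const (of_nat (multinomial d i)) * (\<Prod>j=1..d. elem_sym j ^ i j))"
proof -
  have "(associated_poly k (monom 1 (k + d)) :: ('n, 'a) mpoly) =
      multinomial_sum d (\<lambda>j. (- 1) ^ (j + 1) * elem_sym j) d"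
    using assms by (intro associated_poly_eq_multinomial_sum) auto
  also have "\<dots> = (\<Sum>i\<in>index_tuples d.
      (- 1) ^ Delta d i * Const (of_nat (multinomial d i)) * (\<Prod>j=1..d. elem_sym j ^ i j))"
    unfolding multinomial_sum_def index_tuples_def weight_tuples_eq_PiE
      prod_sign_eq_Delta[symmetric] Const_of_nat
    by (simp only: power_mult_distrib prod.distrib mult_ac)
  finally show ?thesis .
qed

end
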